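(* For $7 \le n \le 20$, the zero forcing number of the generalized Petersen graph $P(n,3)$ takes the following values: $Z(P(7,3)) = 6$, $Z(P(8,3)) = 6$, $Z(P(9,3)) = 6$, $Z(P(10,3)) = 8$, $Z(P(11,3)) = 7$, $Z(P(12,3)) = 7$, and $Z(P(n,3)) = 8$ for every integer $n$ with $13 \le n \le 20$.
   Context: Let $G=(V,E)$ be a finite simple graph. Color a subset $S\subseteq V$ black and the remaining vertices white. Color change rule: a black vertex with exactly one white neighbor forces that neighbor to become black. Iterating this rule starting from $S$ until no further force is possible gives the closure $\mathrm{cl}(S)$. The set $S$ is a zero forcing set of $G$ if $\mathrm{cl}(S)=V$, and the zero forcing number $Z(G)$ is the minimum cardinality of a zero forcing set. For $n\ge 3$ and $1\le k<n/2$, the generalized Petersen graph $P(n,k)$ has the $2n$ vertices $\{u_0,\dots,u_{n-1}\}\cup\{v_0,\dots,v_{n-1}\}$ and edges $u_i\sim u_{i+1}$, $u_i\sim v_i$, and $v_i\sim v_{i+k}$ for all $i$, with indices taken modulo $n$. *)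

theory Defs
  imports "Graph_Theory.Pair_Digraph"
begin

text \<open>
  A finite simple graph is a \<^locale>\<open>pair_graph\<close>: a finite vertex set \<^const>\<open>pverts\<close>
  together with a symmetric, irreflexive set \<^const>\<open>parcs\<close> of ordered pairs, each undirected
  edge being present in both directions.
\<close>

definition white_neighbors :: "'a pair_pre_digraph \<Rightarrow> 'a set \<Rightarrow> 'a \<Rightarrow> 'a set" where
  "white_neighbors G B u = {w \<in> pverts G - B. (u, w) \<in> parcs G}"

inductive force_step :: "'a pair_pre_digraph \<Rightarrow> 'a set \<Rightarrow> 'a set \<Rightarrow> bool"
  for G :: "'a pair_pre_digraph" where
  force: "\<lbrakk>u \<in> B; white_neighbors G B u = {w}\<rbrakk> \<Longrightarrow> force_step G B (insert w B)"

definition stalled :: "'a pair_pre_digraph \<Rightarrow> 'a set \<Rightarrow> bool" where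
  "stalled G B \<longleftrightarrow> \<not> (\<exists>C. force_step G B C)"

text \<open>
  The final black set does not depend on the order of the forces; this is lemma
  \<open>ex1_forcing_closure\<close> below, so the definite description is meaningful.
\<close>

definition forcing_closure :: "'a pair_pre_digraph \<Rightarrow> 'a set \<Rightarrow> 'a set" where
  "forcing_closure G S = (THE C. (force_step G)\<^sup>*\<^sup>* S C \<and> stalled G C)"

definition zero_forcing_set :: "'a pair_pre_digraph \<Rightarrow> 'a set \<Rightarrow> bool" where
  "zero_forcing_set G S \<longleftrightarrow> S \<subseteq> pverts G \<and> forcing_closure G S = pverts G"

definition zero_forcing_number :: "'a pair_pre_digraph \<Rightarrow> nat" where
  "zero_forcing_number G = (LEAST m. \<exists>S. zero_forcing_set G S \<and> card S = m)"

lemma forced_subset_stalled: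
  assumes "(force_step G)\<^sup>*\<^sup>* S C" "stalled G T" "S \<subseteq> T"
  shows "C \<subseteq> T"
  using assms(1)
proof (induction rule: rtranclp_induct)
  case base
  then show ?case using assms(3) .
next
  case (step B C)
  from step.hyps(2) obtain u w where uw: "u \<in> B" "white_neighbors G B u = {w}" "C = insert w B"
    by cases auto
  have "w \<in> T"
  proof (rule ccontr)
    assume "w \<notin> T"
    then have "white_neighbors G T u = {w}"
      using uw(2) step.IH unfolding white_neighbors_def by blast
    then have "force_step G T (insert w T)"
      using uw(1) step.IH by (blast intro: force_step.force)
    then show False using assms(2) unfolding stalled_def by blast
  qed
  then show ?case using uw(3) step.IH by blast
qed

lemma ex1_forcing_closure:
  assumes "finite (pverts G)"
  shows "\<exists>!C. (force_step G)\<^sup>*\<^sup>* S C \<and> stalled G C"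
proof (rule ex_ex1I)
  show "\<exists>C. (force_step G)\<^sup>*\<^sup>* S C \<and> stalled G C"
  proof (induction "card (pverts G - S)" arbitrary: S rule: less_induct)
    case less
    show ?case
    proof (cases "stalled G S")
      case True
      then show ?thesis by blast
    next
      case False
      then obtain u w where uw: "u \<in> S" "white_neighbors G S u = {w}"
        unfolding stalled_def by (auto elim: force_step.cases)
      then have w: "w \<in> pverts G - S" unfolding white_neighbors_def by blast
      then have "pverts G - insert w S \<subset> pverts G - S" by blast
      then have "card (pverts G - insert w S) < card (pverts G - S)"
        using assms by (intro psubset_card_mono) auto
      then obtain C where "(force_step G)\<^sup>*\<^sup>* (insert w S) C" "stalled G C"
        using less by blast
      moreover have "force_step G S (insert w S)"
        using uw by (rule force_step.force)
      ultimately show ?thesis by (meson converse_rtranclp_into_rtranclp)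
    qed
  qed
next
  fix C D
  assume C: "(force_step G)\<^sup>*\<^sup>* S C \<and> stalled G C" and D: "(force_step G)\<^sup>*\<^sup>* S D \<and> stalled G D"
  have sup: "S \<subseteq> E" if "(force_step G)\<^sup>*\<^sup>* S E" for E
    using that by (induction rule: rtranclp_induct) (auto elim: force_step.cases)
  show "C = D"
    using C D sup forced_subset_stalled by (meson subset_antisym)
qed

lemma zero_forcing_set_pverts:
  assumes "finite (pverts G)"
  shows "zero_forcing_set G (pverts G)"
proof -
  have "stalled G (pverts G)"
    unfolding stalled_def by (auto elim!: force_step.cases simp: white_neighbors_def)
  then have "forcing_closure G (pverts G) = pverts G"
    unfolding forcing_closure_def
    by (intro the1_equality ex1_forcing_closure assms) simp
  then show ?thesis unfolding zero_forcing_set_def by simp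
qed

datatype gp_vertex = U nat | V nat

definition gp_edges :: "nat \<Rightarrow> nat \<Rightarrow> gp_vertex rel" where
  "gp_edges n k =
     {(U i, U ((i + 1) mod n)) | i. i < n} \<union>
     {(U i, V i) | i. i < n} \<union>
     {(V i, V ((i + k) mod n)) | i. i < n}"

text \<open>
  The construction is total; it is the generalized Petersen graph $P(n,k)$, a finite simple
  graph, for $n \ge 3$ and $1 \le k < n/2$ (lemma \<open>pair_graph_generalized_petersen\<close>).
\<close>

definition generalized_petersen :: "nat \<Rightarrow> nat \<Rightarrow> gp_vertex pair_pre_digraph" where
  "generalized_petersen n k =
     \<lparr>pverts = U ` {..<n} \<union> V ` {..<n}, parcs = gp_edges n k \<union> (gp_edges n k)\<inverse>\<rparr>"

lemma mod_add_neq_self: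
  fixes i j n :: nat
  assumes "i < n" "0 < j" "j < n"
  shows "(i + j) mod n \<noteq> i"
  using assms by (cases "i + j < n") (auto simp: mod_if)

lemma pair_graph_generalized_petersen:
  assumes "n \<ge> 3" "1 \<le> k" "2 * k < n"
  shows "pair_graph (generalized_petersen n k)"
proof -
  let ?G = "generalized_petersen n k"
  have sub: "parcs ?G \<subseteq> pverts ?G \<times> pverts ?G"
    using assms by (auto simp: generalized_petersen_def gp_edges_def)
  have fin: "finite (pverts ?G)"
    by (simp add: generalized_petersen_def)
  have irrefl: "fst e \<noteq> snd e" if "e \<in> parcs ?G" for e
    using that assms mod_add_neq_self[of _ n 1] mod_add_neq_self[of _ n k]
    by (auto simp: generalized_petersen_def gp_edges_def) (metis Suc_eq_plus1 mod_add_neq_self)+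
  have "sym (parcs ?G)"
    by (auto simp: generalized_petersen_def sym_def)
  then have "symmetric (with_proj ?G)"
    by (simp add: symmetric_def)
  then show ?thesis
    using sub fin irrefl finite_subset[OF sub]
    by unfold_locales auto
qed

end

theory Submission
  imports Defs
begin

text \<open>
  Let $S$ be a zero forcing set and $T$ a vertex set with $S \cup T \neq V$. Forcing from
  $S \cup T$ is not stalled, so some $v$ has exactly one white neighbour; every other vertex of
  $N[v] - T$ lies in $S$. Passing from $T$ to $T \cup N[v]$ therefore uses up exactly
  $|N[v] - T| - 1$ vertices of $S - T$. Starting from $T = N[u_0]$ or $T = N[v_0]$ (which is
  enough by rotation) one searches through all such moves whose total cost stays within the
  hypothetical size of $S$; since $T$ never becomes large enough for the rest of $S$ to fill up
  the graph, no zero forcing set of that size exists. Only moves of positive cost branch: for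
  $n \le 20$ and sets of size 7 this leaves about 3000 cases per graph.
\<close>

section \<open>Zero forcing and stalled sets\<close>

text \<open>The closure of \<open>S\<close> is the least stalled superset of \<open>S\<close> by
  \<open>forced_subset_stalled\<close>, so it is the whole vertex set iff no proper stalled superset
  exists. From here on, sequences of forces are replaced by stalled sets.\<close>

lemma zero_forcing_set_iff_stalled:
  assumes "finite (pverts G)"
  shows "zero_forcing_set G S \<longleftrightarrow>
    S \<subseteq> pverts G \<and> (\<forall>T. S \<subseteq> T \<and> T \<subseteq> pverts G \<and> stalled G T \<longrightarrow> T = pverts G)"
proof -
  obtain C where C: "(force_step G)\<^sup>*\<^sup>* S C" "stalled G C"
    using ex1_forcing_closure[OF assms] by blast
  have eq: "forcing_closure G S = C"
    unfolding forcing_closure_def using C by (intro the1_equality ex1_forcing_closure assms) simp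
  have sub: "S \<subseteq> C"
    using C(1) by (induction rule: rtranclp_induct) (auto elim: force_step.cases)
  have verts: "C \<subseteq> pverts G" if "S \<subseteq> pverts G"
    using C(1) by (induction rule: rtranclp_induct)
      (use that in \<open>auto elim!: force_step.cases simp: white_neighbors_def\<close>)
  show ?thesis
    using forced_subset_stalled[OF C(1)] sub verts C(2)
    unfolding zero_forcing_set_def eq by blast
qed

text \<open>\<open>T\<close> is the region already accounted for and \<open>b\<close> the budget for
  the rest of \<open>S\<close>. With \<open>T = {}\<close> this says that the zero forcing number
  exceeds \<open>b\<close>.\<close>

definition secure :: "'a pair_pre_digraph \<Rightarrow> nat \<Rightarrow> 'a set \<Rightarrow> bool" where
  "secure G b T \<longleftrightarrow> (\<forall>S. zero_forcing_set G S \<longrightarrow> b < card (S - T))"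

lemma zero_forcing_set_finite:
  assumes "finite (pverts G)" "zero_forcing_set G S"
  shows "finite S"
  using assms unfolding zero_forcing_set_def by (auto intro: finite_subset)

lemma secure_antimono:
  assumes "finite (pverts G)" "secure G b T'" "T \<subseteq> T'"
  shows "secure G b T"
  unfolding secure_def
proof (intro allI impI)
  fix S assume S: "zero_forcing_set G S"
  have "card (S - T') \<le> card (S - T)"
    using zero_forcing_set_finite[OF assms(1) S] assms(3) by (intro card_mono) auto
  then show "b < card (S - T)"
    using assms(2) S unfolding secure_def by fastforce
qed

text \<open>By contradiction: a zero forcing set with at most \<open>b\<close> vertices outside
  \<open>T\<close> leaves some vertex white together with \<open>T\<close>, hence some force by a
  \<open>v\<close> is possible. It pays \<open>k\<close> vertices of the budget, and
  \<open>S\<close> then contradicts security of the enlarged region. The white neighbour lies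
  outside \<open>T\<close>, so only \<open>v\<close> with \<open>\<not> N v \<subseteq> T\<close>
  occur.\<close>

lemma secure_step:
  assumes fin: "finite (pverts G)" and T: "T \<subseteq> pverts G" and b: "b < card (pverts G - T)"
    and nb: "\<And>v. v \<in> pverts G \<Longrightarrow> {w. (v, w) \<in> parcs G} = N v"
    and N: "\<And>v. v \<in> pverts G \<Longrightarrow> N v \<subseteq> pverts G"
    and step: "\<And>v k. v \<in> pverts G \<Longrightarrow> \<not> N v \<subseteq> T \<Longrightarrow> card (insert v (N v) - T) = Suc k \<Longrightarrow> k \<le> b
       \<Longrightarrow> secure G (b - k) (T \<union> insert v (N v))"
  shows "secure G b T"
  unfolding secure_def
proof (intro allI impI, rule ccontr)
  fix S assume S: "zero_forcing_set G S" and "\<not> b < card (S - T)"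
  then have le: "card (S - T) \<le> b" by simp
  have finS: "finite S" and subS: "S \<subseteq> pverts G"
    using zero_forcing_set_finite[OF fin S] S unfolding zero_forcing_set_def by auto
  have "S \<union> T \<noteq> pverts G"
  proof
    assume "S \<union> T = pverts G"
    then have "card (pverts G - T) \<le> card (S - T)"
      using finS by (intro card_mono) auto
    then show False using b le by simp
  qed
  then have "\<not> stalled G (S \<union> T)"
    using S T subS unfolding zero_forcing_set_iff_stalled[OF fin] by blast
  then obtain v w where v: "v \<in> S \<union> T" and w: "white_neighbors G (S \<union> T) v = {w}"
    unfolding stalled_def by (auto elim!: force_step.cases)
  have vV: "v \<in> pverts G" using v T subS by blast
  have wN: "w \<in> N v" "w \<notin> S" "w \<notin> T" and others: "N v - {w} \<subseteq> S \<union> T"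
    using w nb[OF vV] N[OF vV] unfolding white_neighbors_def by auto
  define D where "D = insert v (N v) - T"
  have finD: "finite D"
    unfolding D_def using N[OF vV] fin finite_subset by blast
  \<comment> \<open>Both \<open>v\<close> and its neighbours other than \<open>w\<close> lie in
    \<open>S \<union> T\<close>, so all of \<open>D\<close> except \<open>w\<close> belongs to
    \<open>S\<close>: these are the vertices paid for.\<close>
  have split: "S - T = (S - (T \<union> insert v (N v))) \<union> (D - {w})"
    unfolding D_def using v others wN by auto
  have "card (S - T) = card (S - (T \<union> insert v (N v))) + card (D - {w})"
    unfolding split by (rule card_Un_disjoint) (use finS finD in \<open>auto simp: D_def\<close>)
  moreover have D: "card D = Suc (card (D - {w}))"
    using finD wN by (intro card.remove) (auto simp: D_def)
  ultimately have *: "card (S - T) = card (S - (T \<union> insert v (N v))) + card (D - {w})" by simp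
  have "secure G (b - card (D - {w})) (T \<union> insert v (N v))"
    using vV wN D * le unfolding D_def by (intro step) auto
  then have "b - card (D - {w}) < card (S - (T \<union> insert v (N v)))"
    using S unfolding secure_def by blast
  then show False using * le by simp
qed

section \<open>Invariance under automorphisms\<close>

lemma zero_forcing_set_image:
  assumes fin: "finite (pverts G)" and bij: "bij_betw f (pverts G) (pverts G)"
    and arcs: "\<And>u w. u \<in> pverts G \<Longrightarrow> w \<in> pverts G \<Longrightarrow> (f u, f w) \<in> parcs G \<longleftrightarrow> (u, w) \<in> parcs G"
    and S: "zero_forcing_set G S"
  shows "zero_forcing_set G (f ` S)"
proof -
  let ?V = "pverts G"
  have inj: "inj_on f ?V" and im: "f ` ?V = ?V"
    using bij unfolding bij_betw_def by auto
  have fV: "f v \<in> ?V" if "v \<in> ?V" for v using im that by blast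
  have SV: "S \<subseteq> ?V" using S unfolding zero_forcing_set_def by simp
  have "T = ?V" if T: "f ` S \<subseteq> T" "T \<subseteq> ?V" "stalled G T" for T
  proof -
    define T' where "T' = {v \<in> ?V. f v \<in> T}"
    have "stalled G T'"
      unfolding stalled_def
    proof
      assume "\<exists>C. force_step G T' C"
      then obtain u w where u: "u \<in> T'" and w: "white_neighbors G T' u = {w}"
        by (auto elim: force_step.cases)
      have uV: "u \<in> ?V" using u unfolding T'_def by simp
      have "white_neighbors G T (f u) = f ` white_neighbors G T' u"
      proof (intro set_eqI iffI)
        fix x assume x: "x \<in> white_neighbors G T (f u)"
        then obtain y where "y \<in> ?V" "x = f y"
          using im unfolding white_neighbors_def by blast
        then show "x \<in> f ` white_neighbors G T' u"
          using x arcs[OF uV] unfolding white_neighbors_def T'_def by auto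
      next
        fix x assume "x \<in> f ` white_neighbors G T' u"
        then obtain y where y: "y \<in> ?V" "f y \<notin> T" "(u, y) \<in> parcs G" "x = f y"
          unfolding white_neighbors_def T'_def by blast
        then show "x \<in> white_neighbors G T (f u)"
          using arcs[OF uV y(1)] fV unfolding white_neighbors_def by simp
      qed
      then have "white_neighbors G T (f u) = {f w}" using w by simp
      then have "force_step G T (insert (f w) T)"
        using u unfolding T'_def by (intro force_step.force) auto
      then show False using T(3) unfolding stalled_def by blast
    qed
    moreover have "S \<subseteq> T'" "T' \<subseteq> ?V"
      using SV T(1) unfolding T'_def by auto
    ultimately have "T' = ?V"
      using S unfolding zero_forcing_set_iff_stalled[OF fin] by blast
    then have "f v \<in> T" if "v \<in> ?V" for v
      using that unfolding T'_def by auto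
    then have "f ` ?V \<subseteq> T" by auto
    then show "T = ?V"
      using T(2) unfolding im by (rule subset_antisym[rotated])
  qed
  moreover have "f ` S \<subseteq> ?V" using SV im by blast
  ultimately show ?thesis
    unfolding zero_forcing_set_iff_stalled[OF fin] by blast
qed

lemma secure_image:
  assumes fin: "finite (pverts G)" and bij: "bij_betw f (pverts G) (pverts G)"
    and arcs: "\<And>u w. u \<in> pverts G \<Longrightarrow> w \<in> pverts G \<Longrightarrow> (f u, f w) \<in> parcs G \<longleftrightarrow> (u, w) \<in> parcs G"
    and T: "T \<subseteq> pverts G" and sec: "secure G b (f ` T)"
  shows "secure G b T"
  unfolding secure_def
proof (intro allI impI)
  fix S assume S: "zero_forcing_set G S"
  then have SV: "S \<subseteq> pverts G" unfolding zero_forcing_set_def by simp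
  have inj: "inj_on f (pverts G)" using bij unfolding bij_betw_def by simp
  have "f ` S - f ` T = f ` (S - T)"
    using inj_on_image_set_diff[OF inj, of S T] SV T by blast
  moreover have "card (f ` (S - T)) = card (S - T)"
    using SV by (intro card_image inj_on_subset[OF inj]) auto
  ultimately show "b < card (S - T)"
    using sec zero_forcing_set_image[OF fin bij arcs S] unfolding secure_def by metis
qed

lemma zero_forcing_number_eqI:
  assumes "finite (pverts G)" "zero_forcing_set G S" "card S = Suc b" "secure G b {}"
  shows "zero_forcing_number G = Suc b"
  unfolding zero_forcing_number_def
proof (rule Least_equality)
  show "\<exists>S. zero_forcing_set G S \<and> card S = Suc b" using assms by blast
next
  fix m assume "\<exists>S. zero_forcing_set G S \<and> card S = m"
  then show "Suc b \<le> m" using assms(4) unfolding secure_def by fastforce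
qed

section \<open>The generalized Petersen graphs $P(n,3)$\<close>

text \<open>Predecessors are reached by adding \<open>n - 1\<close> or \<open>n - 3\<close>, which
  avoids truncated subtraction and matches the list rotations used later.\<close>

fun nbrs :: "nat \<Rightarrow> gp_vertex \<Rightarrow> gp_vertex set" where
  "nbrs n (U i) = {U ((i + (n - 1)) mod n), U ((i + 1) mod n), V i}"
| "nbrs n (V i) = {V ((i + (n - 3)) mod n), V ((i + 3) mod n), U i}"

abbreviation gp_verts :: "nat \<Rightarrow> gp_vertex set" where
  "gp_verts n \<equiv> U ` {..<n} \<union> V ` {..<n}"

lemma pverts_generalized_petersen: "pverts (generalized_petersen n k) = gp_verts n"
  by (simp add: generalized_petersen_def)

lemma finite_verts: "finite (pverts (generalized_petersen n k))"
  by (simp add: pverts_generalized_petersen)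

lemma add_mod_eq_iff:
  fixes i j n k :: nat
  assumes "i < n" "j < n" "k \<le> n"
  shows "(i + k) mod n = j \<longleftrightarrow> i = (j + (n - k)) mod n"
proof
  assume "(i + k) mod n = j"
  then have "(j + (n - k)) mod n = (i + k + (n - k)) mod n" by (metis mod_add_left_eq)
  also have "\<dots> = i" using assms by simp
  finally show "i = (j + (n - k)) mod n" by simp
next
  assume "i = (j + (n - k)) mod n"
  then have "(i + k) mod n = (j + (n - k) + k) mod n" by (metis mod_add_left_eq)
  also have "\<dots> = j" using assms by simp
  finally show "(i + k) mod n = j" .
qed

lemma add_mod_inj:
  fixes i j k n :: nat
  assumes "j < n" "k < n" "(i + j) mod n = (i + k) mod n"
  shows "j = k"
proof -
  have "k = j" if "j \<le> k" "k < n" "(i + k) mod n = (i + j) mod n" for j k :: nat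
  proof -
    have "n dvd (i + k) - (i + j)" using that by (intro mod_eq_dvd_iff_nat[THEN iffD1]) auto
    then have "n dvd k - j" by simp
    then show ?thesis using that nat_dvd_not_less[of "k - j" n] by fastforce
  qed
  then show ?thesis using assms by (metis nat_le_linear)
qed

lemma arcs_generalized_petersen:
  assumes "n > 6" "v \<in> gp_verts n"
  shows "(v, w) \<in> parcs (generalized_petersen n 3) \<longleftrightarrow> w \<in> nbrs n v"
proof (cases v)
  case (U i)
  then have i: "i < n" using assms by auto
  \<comment> \<open>The converse arcs into \<open>U i\<close> come from exactly one index, the
    predecessor of \<open>i\<close>.\<close>
  have "(\<exists>j<n. w = U j \<and> i = (j + 1) mod n) \<longleftrightarrow> w = U ((i + (n - 1)) mod n)"
  proof -
    have "(i + (n - 1)) mod n < n" using assms(1) by simp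
    moreover have "i = (j + 1) mod n \<longleftrightarrow> j = (i + (n - 1)) mod n" if "j < n" for j
      using add_mod_eq_iff[OF that i, of 1] assms(1) by auto
    ultimately show ?thesis by blast
  qed
  then show ?thesis using U i assms(1)
    by (auto simp: generalized_petersen_def gp_edges_def)
next
  case (V i)
  then have i: "i < n" using assms by auto
  have "(\<exists>j<n. w = V j \<and> i = (j + 3) mod n) \<longleftrightarrow> w = V ((i + (n - 3)) mod n)"
  proof -
    have "(i + (n - 3)) mod n < n" using assms(1) by simp
    moreover have "i = (j + 3) mod n \<longleftrightarrow> j = (i + (n - 3)) mod n" if "j < n" for j
      using add_mod_eq_iff[OF that i, of 3] assms(1) by auto
    ultimately show ?thesis by blast
  qed
  then show ?thesis using V i assms(1)
    by (auto simp: generalized_petersen_def gp_edges_def)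
qed

lemma nbrs_subset: "v \<in> gp_verts n \<Longrightarrow> nbrs n v \<subseteq> gp_verts n"
  by (cases v) auto

lemma nbrs_sym:
  assumes "n > 6" "v \<in> gp_verts n" "w \<in> gp_verts n"
  shows "w \<in> nbrs n v \<longleftrightarrow> v \<in> nbrs n w"
proof -
  have "sym (parcs (generalized_petersen n 3))"
    by (auto simp: generalized_petersen_def sym_def)
  then show ?thesis
    using arcs_generalized_petersen[OF assms(1)] assms(2,3) by (meson symD)
qed

section \<open>Rotational symmetry\<close>

fun shift :: "nat \<Rightarrow> nat \<Rightarrow> gp_vertex \<Rightarrow> gp_vertex" where
  "shift n j (U i) = U ((i + j) mod n)"
| "shift n j (V i) = V ((i + j) mod n)"

lemma shift_nbrs:
  "shift n j ` nbrs n v = nbrs n (shift n j v)"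
  by (cases v) (simp_all add: mod_simps ac_simps)

lemma bij_betw_shift:
  assumes "n > 0"
  shows "bij_betw (shift n j) (gp_verts n) (gp_verts n)"
proof -
  have sub: "shift n k ` gp_verts n \<subseteq> gp_verts n" for k using assms by auto
  \<comment> \<open>The inverse rotation; reducing \<open>j\<close> first keeps the difference from
    truncating when \<open>j\<close> exceeds \<open>n\<close>.\<close>
  have inv: "shift n (n - j mod n) (shift n j v) = v" if "v \<in> gp_verts n" for v
  proof -
    have "((i + j) mod n + (n - j mod n)) mod n = i" if "i < n" for i
    proof -
      have "((i + j) mod n + (n - j mod n)) mod n = (i + j mod n + (n - j mod n)) mod n"
        by (metis mod_add_left_eq mod_add_right_eq)
      also have "\<dots> = i" using that assms by simp
      finally show ?thesis .
    qed
    then show ?thesis using that by auto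
  qed
  then have "inj_on (shift n j) (gp_verts n)" by (metis inj_onI)
  then show ?thesis
    unfolding bij_betw_def using endo_inj_surj[of "gp_verts n" "shift n j"] sub[of j] by blast
qed

text \<open>Rotations are automorphisms, so security of a closed neighbourhood may be checked at any
  rotated copy of its centre.\<close>

lemma secure_shift:
  assumes n: "n > 6" and v: "v \<in> gp_verts n"
    and sec: "secure (generalized_petersen n 3) b (insert (shift n j v) (nbrs n (shift n j v)))"
  shows "secure (generalized_petersen n 3) b (insert v (nbrs n v))"
proof (rule secure_image[where f = "shift n j"])
  have bij: "bij_betw (shift n j) (gp_verts n) (gp_verts n)" using n by (intro bij_betw_shift) simp
  then show "bij_betw (shift n j) (pverts (generalized_petersen n 3)) (pverts (generalized_petersen n 3))"
    unfolding pverts_generalized_petersen .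
  fix u w assume "u \<in> pverts (generalized_petersen n 3)" "w \<in> pverts (generalized_petersen n 3)"
  then have uw: "u \<in> gp_verts n" "w \<in> gp_verts n" by (simp_all add: pverts_generalized_petersen)
  have "shift n j u \<in> gp_verts n" using bij uw unfolding bij_betw_def by blast
  then have "(shift n j u, shift n j w) \<in> parcs (generalized_petersen n 3) \<longleftrightarrow>
      shift n j w \<in> shift n j ` nbrs n u"
    by (simp add: arcs_generalized_petersen[OF n] shift_nbrs)
  also have "\<dots> \<longleftrightarrow> w \<in> nbrs n u"
    using bij uw nbrs_subset[OF uw(1)] inj_on_image_mem_iff[of "shift n j" "gp_verts n" w "nbrs n u"]
    unfolding bij_betw_def by blast
  finally show "(shift n j u, shift n j w) \<in> parcs (generalized_petersen n 3) \<longleftrightarrow>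
      (u, w) \<in> parcs (generalized_petersen n 3)"
    using arcs_generalized_petersen[OF n uw(1)] by simp
next
  show "insert v (nbrs n v) \<subseteq> pverts (generalized_petersen n 3)"
    using v nbrs_subset[OF v] by (simp add: pverts_generalized_petersen)
  show "secure (generalized_petersen n 3) b (shift n j ` insert v (nbrs n v))"
    using sec by (simp add: shift_nbrs)
qed (rule finite_verts)

text \<open>Every closed neighbourhood has exactly four vertices, so costs can be counted entrywise.
  The delicate case is i - 3 against i + 3, which are distinct modulo n because n - 3 and 3 are
  distinct residues.\<close>

lemma distinct_nbrs:
  assumes "n > 6" "i < n"
  shows "distinct [U i, U ((i + (n - 1)) mod n), U ((i + 1) mod n), V i]"
    and "distinct [V i, V ((i + (n - 3)) mod n), V ((i + 3) mod n), U i]"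
proof -
  have neq: "(i + j) mod n \<noteq> i" if "0 < j" "j < n" for j
    using mod_add_neq_self assms(2) that by blast
  have "(i + (n - 1)) mod n \<noteq> (i + 1) mod n" "(i + (n - 3)) mod n \<noteq> (i + 3) mod n"
    using add_mod_inj[of "n - 1" n 1 i] add_mod_inj[of "n - 3" n 3 i] assms(1) by linarith+
  then show "distinct [U i, U ((i + (n - 1)) mod n), U ((i + 1) mod n), V i]"
    "distinct [V i, V ((i + (n - 3)) mod n), V ((i + 3) mod n), U i]"
    using neq[of "n - 1"] neq[of 1] neq[of "n - 3"] neq[of 3] assms(1) by simp_all
qed

section \<open>Vertex sets as pairs of Boolean lists\<close>

definition black :: "bool list \<Rightarrow> bool list \<Rightarrow> gp_vertex set" where
  "black us vs = U ` {i. i < length us \<and> us ! i} \<union> V ` {i. i < length vs \<and> vs ! i}"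

lemma U_in_black [simp]: "U i \<in> black us vs \<longleftrightarrow> i < length us \<and> us ! i"
  and V_in_black [simp]: "V i \<in> black us vs \<longleftrightarrow> i < length vs \<and> vs ! i"
  by (auto simp: black_def)

fun rot1 :: "'a list \<Rightarrow> 'a list" where
  "rot1 (a # xs) = xs @ [a]"
| "rot1 [] = []"

fun rot3 :: "'a list \<Rightarrow> 'a list" where
  "rot3 (a # b # c # xs) = xs @ [a, b, c]"
| "rot3 xs = xs"

text \<open>Rotation the opposite way, by conjugating with \<open>rev\<close>: position i receives
  the entry of i - 1, whereas \<open>rot1\<close> brings that of i + 1.\<close>

definition back1 :: "'a list \<Rightarrow> 'a list" where
  "back1 xs = rev (rot1 (rev xs))"

definition back3 :: "'a list \<Rightarrow> 'a list" where
  "back3 xs = rev (rot3 (rev xs))"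

lemma rot1_eq_rotate: "rot1 xs = rotate 1 xs"
  by (cases xs) simp_all

lemma rot3_eq_rotate: "length xs \<ge> 3 \<Longrightarrow> rot3 xs = rotate 3 xs"
  by (cases xs rule: rot3.cases) (simp_all add: numeral_3_eq_3)

lemma back1_eq_rotate: "length xs > 1 \<Longrightarrow> back1 xs = rotate (length xs - 1) xs"
  by (simp add: back1_def rot1_eq_rotate[unfolded One_nat_def] rotate_rev[of 1, simplified])

lemma back3_eq_rotate: "length xs > 3 \<Longrightarrow> back3 xs = rotate (length xs - 3) xs"
  by (simp add: back3_def rot3_eq_rotate rotate_rev)

fun map4 :: "('a \<Rightarrow> 'b \<Rightarrow> 'c \<Rightarrow> 'd \<Rightarrow> 'e) \<Rightarrow> 'a list \<Rightarrow> 'b list \<Rightarrow> 'c list \<Rightarrow> 'd list \<Rightarrow> 'e list" where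
  "map4 f (a # as) (b # bs) (c # cs) (d # ds) = f a b c d # map4 f as bs cs ds"
| "map4 f _ _ _ _ = []"

lemma map4:
  assumes "length as = n" "length bs = n" "length cs = n" "length ds = n"
  shows "length (map4 f as bs cs ds) = n \<and>
    (\<forall>i<n. map4 f as bs cs ds ! i = f (as ! i) (bs ! i) (cs ! i) (ds ! i))"
  using assms
proof (induction f as bs cs ds arbitrary: n rule: map4.induct)
  case (1 f a as b bs c cs d ds)
  then show ?case
    by (cases n) (auto simp: nth_Cons split: nat.splits)
qed auto

text \<open>Aligns the colour of each outer vertex with those of its neighbours, so one pass over
  rotated lists treats the whole cycle without index arithmetic.\<close>

definition map_outer :: "(bool \<Rightarrow> bool \<Rightarrow> bool \<Rightarrow> bool \<Rightarrow> 'a) \<Rightarrow> bool list \<Rightarrow> bool list \<Rightarrow> 'a list" where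
  "map_outer f us vs = map4 f us (back1 us) (rot1 us) vs"

definition map_inner :: "(bool \<Rightarrow> bool \<Rightarrow> bool \<Rightarrow> bool \<Rightarrow> 'a) \<Rightarrow> bool list \<Rightarrow> bool list \<Rightarrow> 'a list" where
  "map_inner f us vs = map4 f vs (back3 vs) (rot3 vs) us"

lemma map_outer:
  assumes "n > 6" "length us = n" "length vs = n"
  shows "length (map_outer f us vs) = n"
    and "i < n \<Longrightarrow> map_outer f us vs ! i =
      f (us ! i) (us ! ((i + (n - 1)) mod n)) (us ! ((i + 1) mod n)) (vs ! i)"
  using map4[of us n "back1 us" "rot1 us" vs f] assms
  by (auto simp: map_outer_def back1_eq_rotate rot1_eq_rotate nth_rotate ac_simps simp del: rotate_Suc)

lemma map_inner:
  assumes "n > 6" "length us = n" "length vs = n"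
  shows "length (map_inner f us vs) = n"
    and "i < n \<Longrightarrow> map_inner f us vs ! i =
      f (vs ! i) (vs ! ((i + (n - 3)) mod n)) (vs ! ((i + 3) mod n)) (us ! i)"
  using map4[of vs n "back3 vs" "rot3 vs" us f] assms
  by (auto simp: map_inner_def back3_eq_rotate rot3_eq_rotate nth_rotate ac_simps)

text \<open>
  With \<open>x\<close> the colour of a vertex and \<open>a\<close>, \<open>b\<close>, \<open>c\<close> those of its neighbours (\<open>True\<close> is black),
  this is the number of further vertices of the zero forcing set needed for a force by that
  vertex, and \<open>None\<close> if it has no white neighbour.
\<close>

definition force_cost :: "bool \<Rightarrow> bool \<Rightarrow> bool \<Rightarrow> bool \<Rightarrow> nat option" where
  "force_cost x a b c = (if a \<and> b \<and> c then None
     else Some (length (filter Not [x, a, b, c]) - 1))"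

text \<open>A complete case table, so that each cost is found by a single rewrite during
  evaluation.\<close>

lemma force_cost_code [code]:
  "force_cost x True True True = None"
  "force_cost True True True False = Some 0"
  "force_cost True True False True = Some 0"
  "force_cost True False True True = Some 0"
  "force_cost True True False False = Some 1"
  "force_cost True False True False = Some 1"
  "force_cost True False False True = Some 1"
  "force_cost True False False False = Some 2"
  "force_cost False True True False = Some 1"
  "force_cost False True False True = Some 1"
  "force_cost False False True True = Some 1"
  "force_cost False True False False = Some 2"
  "force_cost False False True False = Some 2"
  "force_cost False False False True = Some 2"
  "force_cost False False False False = Some 3"
  by (simp_all add: force_cost_def)

text \<open>As the four vertices are distinct, counting \<open>False\<close> entries counts white
  vertices. The right-hand side is the form in which \<open>secure_step\<close> presents a
  move.\<close>

lemma force_cost_eq_Some_iff: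
  assumes "distinct [v, a, b, c]"
  shows "force_cost (v \<in> T) (a \<in> T) (b \<in> T) (c \<in> T) = Some k \<longleftrightarrow>
    \<not> {a, b, c} \<subseteq> T \<and> card ({v, a, b, c} - T) = Suc k"
proof -
  have "v \<noteq> a" "v \<noteq> b" "v \<noteq> c" "a \<noteq> b" "a \<noteq> c" "b \<noteq> c" using assms by auto
  then show ?thesis
    by (cases "v \<in> T"; cases "a \<in> T"; cases "b \<in> T"; cases "c \<in> T")
      (simp_all add: force_cost_def insert_Diff_if)
qed

definition some_true :: "bool \<Rightarrow> bool \<Rightarrow> bool \<Rightarrow> bool \<Rightarrow> bool" where
  "some_true x a b c \<longleftrightarrow> x \<or> a \<or> b \<or> c"

lemma some_true_code [code]:
  "some_true True a b c = True"
  "some_true False True b c = True"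
  "some_true False False True c = True"
  "some_true False False False c = c"
  by (simp_all add: some_true_def)

fun disj_lists :: "bool list \<Rightarrow> bool list \<Rightarrow> bool list" where
  "disj_lists (x # xs) (True # ys) = True # disj_lists xs ys"
| "disj_lists (x # xs) (False # ys) = x # disj_lists xs ys"
| "disj_lists _ _ = []"

lemma disj_lists:
  assumes "length xs = n" "length ys = n"
  shows "length (disj_lists xs ys) = n \<and> (\<forall>i<n. disj_lists xs ys ! i = (xs ! i \<or> ys ! i))"
  using assms
  by (induction xs ys arbitrary: n rule: disj_lists.induct) (auto simp: nth_Cons split: nat.splits)

definition add_outer :: "bool list \<Rightarrow> bool list \<Rightarrow> bool list \<Rightarrow> bool list" where
  "add_outer us fu fv = disj_lists us (map_outer some_true fu fv)"

definition add_inner :: "bool list \<Rightarrow> bool list \<Rightarrow> bool list \<Rightarrow> bool list" where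
  "add_inner vs fu fv = disj_lists vs (map_inner some_true fu fv)"

lemma length_add:
  assumes "n > 6" "length us = n" "length vs = n" "length fu = n" "length fv = n"
  shows "length (add_outer us fu fv) = n" "length (add_inner vs fu fv) = n"
  using assms disj_lists map_outer(1) map_inner(1) unfolding add_outer_def add_inner_def by metis+

lemma nth_add:
  assumes "n > 6" "length us = n" "length vs = n" "length fu = n" "length fv = n" "i < n"
  shows "add_outer us fu fv ! i \<longleftrightarrow> us ! i \<or>
      some_true (fu ! i) (fu ! ((i + (n - 1)) mod n)) (fu ! ((i + 1) mod n)) (fv ! i)"
    and "add_inner vs fu fv ! i \<longleftrightarrow> vs ! i \<or>
      some_true (fv ! i) (fv ! ((i + (n - 3)) mod n)) (fv ! ((i + 3) mod n)) (fu ! i)"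
  using assms disj_lists map_outer map_inner unfolding add_outer_def add_inner_def by metis+

lemma black_subset_gp_verts: "length us = n \<Longrightarrow> length vs = n \<Longrightarrow> black us vs \<subseteq> gp_verts n"
  by (auto simp: black_def)

text \<open>The lists gather rather than spread: a position is painted if it or one of its
  neighbours is flagged. Symmetry of adjacency turns this into the union of the closed
  neighbourhoods of all flagged vertices.\<close>

lemma black_add:
  assumes "n > 6" "length us = n" "length vs = n" "length fu = n" "length fv = n"
  shows "black (add_outer us fu fv) (add_inner vs fu fv) =
    black us vs \<union> (\<Union>v\<in>black fu fv. insert v (nbrs n v))" (is "?L = ?R")
proof -
  have mem: "v \<in> ?L \<longleftrightarrow> v \<in> black us vs \<or> v \<in> black fu fv \<or> nbrs n v \<inter> black fu fv \<noteq> {}"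
    if "v \<in> gp_verts n" for v
  proof (cases v)
    case (U i)
    then have "i < n" and *: "(i + j) mod n < n" for j using that assms(1) by auto
    then show ?thesis
      unfolding U using nth_add(1)[OF assms] length_add[OF assms] assms *[of 1] *[of "n - 1"]
      by (auto simp: some_true_def simp del: One_nat_def add_Suc_right)
  next
    case (V i)
    then have "i < n" and *: "(i + j) mod n < n" for j using that assms(1) by auto
    then show ?thesis
      unfolding V using nth_add(2)[OF assms] length_add[OF assms] assms *[of 3] *[of "n - 3"]
      by (auto simp: some_true_def)
  qed
  have sub: "?L \<subseteq> gp_verts n" "black us vs \<subseteq> gp_verts n" "black fu fv \<subseteq> gp_verts n"
    using assms length_add[OF assms] black_subset_gp_verts by blast+
  show ?thesis
  proof (rule set_eqI)
    fix v show "v \<in> ?L \<longleftrightarrow> v \<in> ?R"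
    proof (cases "v \<in> gp_verts n")
      case True
      then have "nbrs n v \<inter> black fu fv \<noteq> {} \<longleftrightarrow> (\<exists>w\<in>black fu fv. v \<in> nbrs n w)"
        using sub(3) nbrs_sym[OF assms(1) True] by blast
      then show ?thesis using mem[OF True] by blast
    next
      case False
      then show ?thesis using sub nbrs_subset by blast
    qed
  qed
qed

lemma cost_iff:
  assumes "n > 6" "length us = n" "length vs = n"
  shows "i < n \<Longrightarrow> map_outer force_cost us vs ! i = Some k \<longleftrightarrow>
      \<not> nbrs n (U i) \<subseteq> black us vs \<and> card (insert (U i) (nbrs n (U i)) - black us vs) = Suc k"
    and "i < n \<Longrightarrow> map_inner force_cost us vs ! i = Some k \<longleftrightarrow>
      \<not> nbrs n (V i) \<subseteq> black us vs \<and> card (insert (V i) (nbrs n (V i)) - black us vs) = Suc k"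
proof -
  assume i: "i < n"
  have *: "(i + j) mod n < n" for j using assms(1) by simp
  have "distinct [U i, U ((i + (n - 1)) mod n), U ((i + 1) mod n), V i]"
    using distinct_nbrs(1)[OF assms(1) i] by simp
  from force_cost_eq_Some_iff[OF this, of "black us vs" k]
  show "map_outer force_cost us vs ! i = Some k \<longleftrightarrow>
      \<not> nbrs n (U i) \<subseteq> black us vs \<and> card (insert (U i) (nbrs n (U i)) - black us vs) = Suc k"
    using map_outer(2)[OF assms i, of force_cost] assms i * by simp
next
  assume i: "i < n"
  have *: "(i + j) mod n < n" for j using assms(1) by simp
  have "distinct [V i, V ((i + (n - 3)) mod n), V ((i + 3) mod n), U i]"
    using distinct_nbrs(2)[OF assms(1) i] by simp
  from force_cost_eq_Some_iff[OF this, of "black us vs" k]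
  show "map_inner force_cost us vs ! i = Some k \<longleftrightarrow>
      \<not> nbrs n (V i) \<subseteq> black us vs \<and> card (insert (V i) (nbrs n (V i)) - black us vs) = Suc k"
    using map_inner(2)[OF assms i, of force_cost] assms i * by simp
qed

section \<open>Exhaustive search\<close>

text \<open>
  The functions below are evaluated by \<open>code_simp\<close>, whose congruence rules for \<open>if\<close>, \<open>case\<close>, \<open>\<and>\<close>
  and \<open>\<or>\<close> make the simplifier traverse already evaluated arguments again. Where this would be
  expensive, control flow is expressed by pattern matching in auxiliary functions instead.
\<close>

fun pay :: "nat \<Rightarrow> nat option \<Rightarrow> nat option" where
  "pay b None = None"
| "pay b (Some 0) = Some b"
| "pay 0 (Some (Suc c)) = None"
| "pay (Suc b) (Some (Suc c)) = pay b (Some c)"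

lemma pay_Some: "k \<le> b \<Longrightarrow> pay b (Some k) = Some (b - k)"
  by (induction b "Some k" arbitrary: k rule: pay.induct) auto

text \<open>Each affordable position yields a list flagging that vertex alone, paired with the
  budget left. The prefix \<open>acc\<close> is meant to hold only \<open>False\<close>, so it can
  grow at its head and be used unreversed.\<close>

fun moves :: "nat \<Rightarrow> bool list \<Rightarrow> nat option list \<Rightarrow> (nat \<times> bool list) list"
  and move :: "nat option \<Rightarrow> nat \<Rightarrow> bool list \<Rightarrow> nat option list \<Rightarrow> (nat \<times> bool list) list" where
  "moves b acc [] = []"
| "moves b acc (c # cs) = move (pay b c) b acc cs"
| "move None b acc cs = moves b (False # acc) cs"
| "move (Some b') b acc cs =
     (b', acc @ True # map (\<lambda>_. False) cs) # moves b (False # acc) cs"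

text \<open>Soundness of the search rests on no affordable move being missed. The prefix length
  \<open>m\<close> is general for the sake of the induction.\<close>

lemma moves_complete:
  assumes "i < length cs" "pay b (cs ! i) = Some b'"
  shows "(b', (replicate (m + length cs) False)[m + i := True]) \<in> set (moves b (replicate m False) cs)"
  using assms
proof (induction cs arbitrary: i m)
  case (Cons c cs)
  have acc: "False # replicate m False = replicate (Suc m) False" by simp
  show ?case
  proof (cases i)
    case 0
    have "replicate (m + length (c # cs)) False = replicate m False @ False # map (\<lambda>_. False) cs"
      by (simp only: replicate_add map_replicate_const length_Cons replicate_Suc)
    then have "(replicate (m + length (c # cs)) False)[m := True] =
        replicate m False @ True # map (\<lambda>_. False) cs"
      by (simp only: list_update_append) simp
    then show ?thesis using Cons.prems 0 by simp
  next
    case (Suc j)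
    have "(b', (replicate (Suc m + length cs) False)[Suc m + j := True]) \<in>
        set (moves b (replicate (Suc m) False) cs)"
      using Cons.prems Suc by (intro Cons.IH) auto
    then show ?thesis using Suc by (cases "pay b c") simp_all
  qed
qed simp

lemma moves_length: "(b', e) \<in> set (moves b acc cs) \<Longrightarrow> length e = length acc + length cs"
  and move_length: "(b', e) \<in> set (move r b acc cs) \<Longrightarrow> length e = Suc (length acc + length cs)"
  by (induction b acc cs and r b acc cs rule: moves_move.induct) auto

fun more_white :: "nat \<Rightarrow> bool list \<Rightarrow> bool" where
  "more_white b [] = False"
| "more_white b (True # xs) = more_white b xs"
| "more_white 0 (False # xs) = True"
| "more_white (Suc b) (False # xs) = more_white b xs"

lemma more_white_iff: "more_white b xs \<longleftrightarrow> b < length (filter Not xs)"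
  by (induction b xs rule: more_white.induct) auto

lemma card_black:
  "card (black us vs) = length (filter id us) + length (filter id vs)"
proof -
  have "card (black us vs) = card (U ` {i. i < length us \<and> us ! i}) + card (V ` {i. i < length vs \<and> vs ! i})"
    unfolding black_def by (rule card_Un_disjoint) auto
  then show ?thesis
    by (simp add: card_image inj_on_def length_filter_conv_card)
qed

lemma card_white:
  assumes "length us = n" "length vs = n"
  shows "card (gp_verts n - black us vs) = length (filter Not (us @ vs))"
proof -
  have "gp_verts n - black us vs = black (map Not us) (map Not vs)"
  proof (rule set_eqI)
    fix v
    show "v \<in> gp_verts n - black us vs \<longleftrightarrow> v \<in> black (map Not us) (map Not vs)"
      using assms by (cases v) auto
  qed
  then show ?thesis by (simp add: card_black filter_map comp_def)
qed

text \<open>Cost 0 means that the closed neighbourhood has a single white vertex and that this is a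
  neighbour: the vertex is black and can force at once.\<close>

fun forcers :: "nat option list \<Rightarrow> bool list" where
  "forcers (Some 0 # cs) = True # forcers cs"
| "forcers (Some (Suc _) # cs) = False # forcers cs"
| "forcers (None # cs) = False # forcers cs"
| "forcers [] = []"

lemma forcers_eq_map: "forcers cs = map (\<lambda>c. c = Some 0) cs"
  by (induction cs rule: forcers.induct) auto

fun any_true :: "bool list \<Rightarrow> bool" where
  "any_true (True # xs) = True"
| "any_true (False # xs) = any_true xs"
| "any_true [] = False"

fun both :: "bool \<Rightarrow> bool \<Rightarrow> bool" where
  "both True q = q"
| "both False q = False"

lemma both_eq [simp]: "both p q \<longleftrightarrow> p \<and> q"
  by (cases p) simp_all

definition all_moves ::
  "nat \<Rightarrow> bool list \<Rightarrow> bool list \<Rightarrow> nat option list \<Rightarrow> nat option list \<Rightarrow> (nat \<times> bool list \<times> bool list) list" where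
  "all_moves b us vs cu cv =
     map (\<lambda>(b', e). (b', e, map (\<lambda>_. False) vs)) (moves b [] cu) @
     map (\<lambda>(b', e). (b', map (\<lambda>_. False) us, e)) (moves b [] cv)"

text \<open>
  The first argument is fuel. Moves of cost 0 are carried out at once; this needs no
  justification, because enlarging the black set only makes the claim stronger
  (lemma \<open>secure_antimono\<close>).
\<close>

function (sequential) safe :: "nat \<Rightarrow> nat \<Rightarrow> bool list \<Rightarrow> bool list \<Rightarrow> bool"
  and safe_list :: "nat \<Rightarrow> (nat \<times> bool list \<times> bool list) list \<Rightarrow> bool list \<Rightarrow> bool list \<Rightarrow> bool"
  and safe_costs :: "nat \<Rightarrow> nat \<Rightarrow> bool list \<Rightarrow> bool list \<Rightarrow>
    nat option list \<Rightarrow> nat option list \<Rightarrow> bool list \<Rightarrow> bool list \<Rightarrow> bool"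
  and safe_if :: "bool \<Rightarrow> nat \<Rightarrow> nat \<Rightarrow> bool list \<Rightarrow> bool list \<Rightarrow>
    nat option list \<Rightarrow> nat option list \<Rightarrow> bool list \<Rightarrow> bool list \<Rightarrow> bool" where
  "safe 0 b us vs = False"
| "safe (Suc k) b us vs =
     (let cu = map_outer force_cost us vs; cv = map_inner force_cost us vs
      in safe_costs k b us vs cu cv (forcers cu) (forcers cv))"
| "safe_costs k b us vs cu cv fu fv =
     safe_if (any_true fu \<or> any_true fv) k b us vs cu cv fu fv"
| "safe_if True k b us vs cu cv fu fv = safe k b (add_outer us fu fv) (add_inner vs fu fv)"
| "safe_if False k b us vs cu cv fu fv =
     both (more_white b (us @ vs)) (safe_list k (all_moves b us vs cu cv) us vs)"
| "safe_list k [] us vs = True"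
| "safe_list k ((b, fu, fv) # ms) us vs =
     both (safe k b (add_outer us fu fv) (add_inner vs fu fv)) (safe_list k ms us vs)"
  by pat_completeness auto
termination
  \<comment> \<open>One unit of fuel pays for the cycle \<open>safe\<close>,
    \<open>safe_costs\<close>, \<open>safe_if\<close>, \<open>safe_list\<close>, with values 4k+4,
    4k+3, 4k+2, 4k+1, back to \<open>safe\<close> at 4k; the length handles the recursion of
    \<open>safe_list\<close> on itself.\<close>
  by (relation "measures
    [\<lambda>x. case x of Inl (Inl (k, _)) \<Rightarrow> 4 * k | Inl (Inr (k, _)) \<Rightarrow> 4 * k + 1
       | Inr (Inl (k, _)) \<Rightarrow> 4 * k + 3 | Inr (Inr (_, k, _)) \<Rightarrow> 4 * k + 2,
     \<lambda>x. case x of Inl (Inr (_, ms, _)) \<Rightarrow> length ms | _ \<Rightarrow> 0]") auto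

lemma all_moves_length:
  assumes "(b', fu, fv) \<in> set (all_moves b us vs cu cv)"
    and "length us = n" "length vs = n" "length cu = n" "length cv = n"
  shows "length fu = n \<and> length fv = n"
  using assms moves_length by (fastforce simp: all_moves_def)

text \<open>\<open>secure_step\<close> read on lists: every affordable move appears in
  \<open>all_moves\<close> with one flagged vertex, and \<open>black_add\<close> identifies the new
  list pair with \<open>T\<close> enlarged by its closed neighbourhood.\<close>

lemma secure_of_moves:
  assumes n: "n > 6" and len: "length us = n" "length vs = n"
    and more: "more_white b (us @ vs)"
    and all: "\<And>b' fu fv. (b', fu, fv) \<in> set (all_moves b us vs (map_outer force_cost us vs) (map_inner force_cost us vs))
      \<Longrightarrow> secure (generalized_petersen n 3) b' (black (add_outer us fu fv) (add_inner vs fu fv))"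
  shows "secure (generalized_petersen n 3) b (black us vs)"
proof (rule secure_step[where N = "nbrs n"])
  show "black us vs \<subseteq> pverts (generalized_petersen n 3)"
    using black_subset_gp_verts[OF len] by (simp add: pverts_generalized_petersen)
  show "b < card (pverts (generalized_petersen n 3) - black us vs)"
    using more card_white[OF len] unfolding more_white_iff by (simp add: pverts_generalized_petersen)
  fix v k
  assume "v \<in> pverts (generalized_petersen n 3)" and white: "\<not> nbrs n v \<subseteq> black us vs"
    and card: "card (insert v (nbrs n v) - black us vs) = Suc k" and k: "k \<le> b"
  then have v: "v \<in> gp_verts n" by (simp add: pverts_generalized_petersen)
  let ?z = "replicate n False"
  have single: "black (?z[i := True]) ?z = {U i}" "black ?z (?z[i := True]) = {V i}" if "i < n" for i
    using that by (auto simp: black_def nth_list_update)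
  show "secure (generalized_petersen n 3) (b - k) (black us vs \<union> insert v (nbrs n v))"
  proof (cases v)
    case (U i)
    then have i: "i < n" using v by auto
    have "map_outer force_cost us vs ! i = Some k"
      using cost_iff(1)[OF n len i] white card U by simp
    then have "(b - k, ?z[i := True]) \<in> set (moves b [] (map_outer force_cost us vs))"
      using moves_complete[of i "map_outer force_cost us vs" b "b - k" 0] i map_outer(1)[OF n len, of force_cost] pay_Some[OF k]
      by simp
    then have "(b - k, ?z[i := True], ?z) \<in> set (all_moves b us vs (map_outer force_cost us vs) (map_inner force_cost us vs))"
      using len unfolding all_moves_def by (force simp: map_replicate_const)
    from all[OF this] show ?thesis
      using black_add[OF n len, of "?z[i := True]" ?z] single(1)[OF i] U by simp
  next
    case (V i)
    then have i: "i < n" using v by auto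
    have "map_inner force_cost us vs ! i = Some k"
      using cost_iff(2)[OF n len i] white card V by simp
    then have "(b - k, ?z[i := True]) \<in> set (moves b [] (map_inner force_cost us vs))"
      using moves_complete[of i "map_inner force_cost us vs" b "b - k" 0] i map_inner(1)[OF n len, of force_cost] pay_Some[OF k]
      by simp
    then have "(b - k, ?z, ?z[i := True]) \<in> set (all_moves b us vs (map_outer force_cost us vs) (map_inner force_cost us vs))"
      using len unfolding all_moves_def by (force simp: map_replicate_const)
    from all[OF this] show ?thesis
      using black_add[OF n len, of ?z "?z[i := True]"] single(2)[OF i] V by simp
  qed
next
  fix v
  assume "v \<in> pverts (generalized_petersen n 3)"
  then have "v \<in> gp_verts n" by (simp add: pverts_generalized_petersen)
  then show "{w. (v, w) \<in> parcs (generalized_petersen n 3)} = nbrs n v"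
    "nbrs n v \<subseteq> pverts (generalized_petersen n 3)"
    using arcs_generalized_petersen[OF n] nbrs_subset by (auto simp: pverts_generalized_petersen)
qed (rule finite_verts)


text \<open>Simultaneous induction along the mutual recursion. Exhausted fuel returns
  \<open>False\<close>, so it proves nothing wrong; the equations for \<open>cu\<close> and
  \<open>cv\<close> record that the costs passed along belong to the current lists.\<close>

lemma safe_secure:
  assumes n: "n > 6"
  shows "safe k b us vs \<Longrightarrow> length us = n \<Longrightarrow> length vs = n \<Longrightarrow>
      secure (generalized_petersen n 3) b (black us vs)"
    and "safe_list k ms us vs \<Longrightarrow> length us = n \<Longrightarrow> length vs = n \<Longrightarrow>
      \<forall>(b, fu, fv) \<in> set ms. length fu = n \<and> length fv = n \<Longrightarrow>
      \<forall>(b, fu, fv) \<in> set ms.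
        secure (generalized_petersen n 3) b (black (add_outer us fu fv) (add_inner vs fu fv))"
    and "safe_costs k b us vs cu cv fu fv \<Longrightarrow> length us = n \<Longrightarrow> length vs = n \<Longrightarrow>
      length fu = n \<Longrightarrow> length fv = n \<Longrightarrow> cu = map_outer force_cost us vs \<Longrightarrow>
      cv = map_inner force_cost us vs \<Longrightarrow> secure (generalized_petersen n 3) b (black us vs)"
    and "safe_if p k b us vs cu cv fu fv \<Longrightarrow> length us = n \<Longrightarrow> length vs = n \<Longrightarrow>
      length fu = n \<Longrightarrow> length fv = n \<Longrightarrow> cu = map_outer force_cost us vs \<Longrightarrow>
      cv = map_inner force_cost us vs \<Longrightarrow> secure (generalized_petersen n 3) b (black us vs)"
proof (induction k b us vs and k ms us vs and k b us vs cu cv fu fv and p k b us vs cu cv fu fv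
    rule: safe_safe_list_safe_costs_safe_if.induct)
  case (2 k b us vs)
  show ?case
    by (rule 2(1)[OF refl refl]) (use 2 n in \<open>simp_all add: Let_def forcers_eq_map map_outer(1) map_inner(1)\<close>)
next
  case (4 k b us vs cu cv fu fv)
  have "secure (generalized_petersen n 3) b (black (add_outer us fu fv) (add_inner vs fu fv))"
    using 4 length_add[OF n] by simp
  then show ?case
    \<comment> \<open>The induction hypothesis concerns a larger region, and shrinking it back
      preserves security.\<close>
    by (rule secure_antimono[OF finite_verts]) (use black_add[OF n] 4 in auto)
next
  case (5 k b us vs cu cv fu fv)
  have len: "\<forall>(b', fu, fv) \<in> set (all_moves b us vs cu cv). length fu = n \<and> length fv = n"
  proof (intro ballI, clarify)
    fix b' fu fv assume "(b', fu, fv) \<in> set (all_moves b us vs cu cv)"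
    then show "length fu = n \<and> length fv = n"
      using 5(3,4) by (rule all_moves_length) (simp_all add: 5 n map_outer(1) map_inner(1))
  qed
  have both: "more_white b (us @ vs)" "safe_list k (all_moves b us vs cu cv) us vs"
    using 5(2) by simp_all
  have "secure (generalized_petersen n 3) b' (black (add_outer us fu fv) (add_inner vs fu fv))"
    if "(b', fu, fv) \<in> set (all_moves b us vs cu cv)" for b' fu fv
    using bspec[OF 5(1)[OF both(2) 5(3,4) len] that] by simp
  then show ?case
    unfolding 5(7,8) by (rule secure_of_moves[OF n 5(3,4) both(1)])
next
  case (7 k b fu fv ms us vs)
  then have "secure (generalized_petersen n 3) b (black (add_outer us fu fv) (add_inner vs fu fv))"
    using length_add[OF n] by simp
  then show ?case using 7 by simp
qed auto

text \<open>
  The first force already costs three vertices, so a budget of \<open>b\<close> here excludes zero forcing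
  sets of size \<open>b + 3\<close>.
\<close>

definition lower_check :: "nat \<Rightarrow> nat \<Rightarrow> bool" where
  "lower_check n b =
     (let z = replicate n False; e = True # replicate (n - 1) False in
      both (safe (2 * n) b (add_outer z e z) (add_inner z e z))
        (safe (2 * n) b (add_outer z z e) (add_inner z z e)))"

text \<open>From the empty region every move costs 3 and leads to a closed neighbourhood, which a
  rotation brings to \<open>U 0\<close> or \<open>V 0\<close>. Fuel \<open>2 * n\<close> suffices,
  as each call of \<open>safe\<close> that continues blackens at least one more vertex.\<close>

lemma secure_of_lower_check:
  assumes n: "n > 6" and b: "b + 3 < 2 * n" and check: "lower_check n b"
  shows "secure (generalized_petersen n 3) (b + 3) {}"
proof -
  let ?G = "generalized_petersen n 3"
  let ?z = "replicate n False" and ?e = "True # replicate (n - 1) False"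
  have black: "black ?z ?z = {}" "black ?e ?z = {U 0}" "black ?z ?e = {V 0}"
  proof -
    have "?e = ?z[0 := True]" using n by (cases n) simp_all
    then show "black ?z ?z = {}" "black ?e ?z = {U 0}" "black ?z ?e = {V 0}"
      using n by (auto simp: black_def nth_list_update)
  qed
  have len: "length ?z = n" "length ?e = n" using n by simp_all
  have "safe (2 * n) b (add_outer ?z ?e ?z) (add_inner ?z ?e ?z)"
    "safe (2 * n) b (add_outer ?z ?z ?e) (add_inner ?z ?z ?e)"
    using check unfolding lower_check_def Let_def by simp_all
  from this[THEN safe_secure(1)[OF n]] have base:
    "secure ?G b (insert (U 0) (nbrs n (U 0)))" "secure ?G b (insert (V 0) (nbrs n (V 0)))"
    using length_add[OF n len(1,1)] len black_add[OF n len(1,1)] black by (simp_all del: nbrs.simps)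
  have all: "secure ?G b (insert v (nbrs n v))" if v: "v \<in> gp_verts n" for v
  proof (cases v)
    case (U i)
    then have "shift n (n - i) v = U 0" using v by auto
    then show ?thesis using secure_shift[OF n v, of b "n - i"] base(1) by metis
  next
    case (V i)
    then have "shift n (n - i) v = V 0" using v by auto
    then show ?thesis using secure_shift[OF n v, of b "n - i"] base(2) by metis
  qed
  have card: "card (insert v (nbrs n v)) = 4" if v: "v \<in> gp_verts n" for v
  proof -
    have "\<exists>xs. insert v (nbrs n v) = set xs \<and> distinct xs \<and> length xs = 4"
    proof (cases v)
      case (U i)
      then show ?thesis using distinct_nbrs(1)[OF n, of i] v
        by (intro exI[of _ "[U i, U ((i + (n - 1)) mod n), U ((i + 1) mod n), V i]"]) auto
    next
      case (V i)
      then show ?thesis using distinct_nbrs(2)[OF n, of i] v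
        by (intro exI[of _ "[V i, V ((i + (n - 3)) mod n), V ((i + 3) mod n), U i]"]) auto
    qed
    then show ?thesis by (auto simp: distinct_card)
  qed
  show ?thesis
  proof (rule secure_step[where N = "nbrs n"])
    show "b + 3 < card (pverts ?G - {})"
      using b card_white[OF len(1,1)] black(1) by (simp add: pverts_generalized_petersen)
    fix v assume "v \<in> pverts ?G"
    then have v: "v \<in> gp_verts n" by (simp add: pverts_generalized_petersen)
    then show "{w. (v, w) \<in> parcs ?G} = nbrs n v" "nbrs n v \<subseteq> pverts ?G"
      using arcs_generalized_petersen[OF n] nbrs_subset by (auto simp: pverts_generalized_petersen)
    fix k assume "card (insert v (nbrs n v) - {}) = Suc k"
    then have "k = 3" using card[OF v] by simp
    then show "secure ?G (b + 3 - k) ({} \<union> insert v (nbrs n v))"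
      using all[OF v] by simp
  qed (simp_all add: finite_verts)
qed

section \<open>Upper bounds by running the forcing process\<close>

fun forces_all :: "nat \<Rightarrow> bool list \<Rightarrow> bool list \<Rightarrow> bool"
  and forces_all_with :: "nat \<Rightarrow> bool list \<Rightarrow> bool list \<Rightarrow> bool list \<Rightarrow> bool list \<Rightarrow> bool" where
  "forces_all 0 us vs = (us = map (\<lambda>_. True) us \<and> vs = map (\<lambda>_. True) vs)"
| "forces_all (Suc k) us vs = forces_all_with k us vs
     (forcers (map_outer force_cost us vs)) (forcers (map_inner force_cost us vs))"
| "forces_all_with k us vs fu fv = forces_all k (add_outer us fu fv) (add_inner vs fu fv)"

text \<open>A round performs all available forces at once and cannot leave a stalled set
  \<open>T\<close> containing the black vertices: otherwise some forcing vertex would have exactly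
  one neighbour white with respect to \<open>T\<close>. If the rounds end all black,
  \<open>T\<close> is everything.\<close>

lemma stalled_forces_all:
  assumes n: "n > 6" and T: "stalled (generalized_petersen n 3) T"
  shows "forces_all k us vs \<Longrightarrow> length us = n \<Longrightarrow> length vs = n \<Longrightarrow> black us vs \<subseteq> T \<Longrightarrow> gp_verts n \<subseteq> T"
proof (induction k arbitrary: us vs)
  case 0
  have "\<forall>i<n. us ! i \<and> vs ! i"
    using 0 by (metis forces_all.simps(1) nth_map)
  then show ?case using 0 by (auto simp: black_def)
next
  case (Suc k)
  let ?fu = "forcers (map_outer force_cost us vs)" and ?fv = "forcers (map_inner force_cost us vs)"
  have len: "length ?fu = n" "length ?fv = n"
    using Suc.prems n by (simp_all add: forcers_eq_map map_outer(1) map_inner(1))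
  have "insert v (nbrs n v) \<subseteq> T" if v: "v \<in> black ?fu ?fv" for v
  proof -
    have vn: "v \<in> gp_verts n" using v black_subset_gp_verts[OF len] by blast
    have cost: "\<not> nbrs n v \<subseteq> black us vs" "card (insert v (nbrs n v) - black us vs) = Suc 0"
      using v cost_iff[OF n Suc.prems(2,3), of _ 0] len
      by (cases v; auto simp: forcers_eq_map simp del: nbrs.simps)+
    then obtain w where w: "insert v (nbrs n v) - black us vs = {w}"
      using card_1_singletonE by (metis One_nat_def)
    have "v \<notin> nbrs n v"
      using vn distinct_nbrs[OF n] by (cases v) auto
    obtain x where x: "x \<in> nbrs n v" "x \<notin> black us vs" using cost(1) by blast
    then have wn: "w \<in> nbrs n v" using w by (metis DiffI insertCI singletonD)
    \<comment> \<open>The single white vertex \<open>w\<close> of the closed neighbourhood is a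
      neighbour, hence different from \<open>v\<close>.\<close>
    have "v \<in> black us vs" using wn w \<open>v \<notin> nbrs n v\<close> by (metis DiffI insertCI singletonD)
    then have vT: "v \<in> T" using Suc.prems(4) by blast
    have sub: "nbrs n v \<subseteq> insert w T" using w Suc.prems(4) by blast
    have "w \<in> T"
    proof (rule ccontr)
      assume "w \<notin> T"
      then have "white_neighbors (generalized_petersen n 3) T v = {w}"
        using wn sub nbrs_subset[OF vn]
        unfolding white_neighbors_def pverts_generalized_petersen arcs_generalized_petersen[OF n vn] by auto
      then show False using T vT unfolding stalled_def by (blast intro: force_step.force)
    qed
    then show ?thesis using sub vT by blast
  qed
  then have "black (add_outer us ?fu ?fv) (add_inner vs ?fu ?fv) \<subseteq> T"
    using black_add[OF n Suc.prems(2,3) len] Suc.prems(4) by blast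
  then show ?case
    using Suc.IH Suc.prems(1) length_add[OF n Suc.prems(2,3) len] by simp
qed

lemma zero_forcing_set_of_forces_all:
  assumes n: "n > 6" and "forces_all k us vs" "length us = n" "length vs = n"
  shows "zero_forcing_set (generalized_petersen n 3) (black us vs)"
  unfolding zero_forcing_set_iff_stalled[OF finite_verts] pverts_generalized_petersen
  using stalled_forces_all[OF n _ assms(2-4)] black_subset_gp_verts[OF assms(3,4)] by blast

definition pad :: "nat \<Rightarrow> bool list \<Rightarrow> bool list" where
  "pad n xs = xs @ replicate (n - length xs) False"

text \<open>One evaluation for both bounds: a witness of size \<open>b + 4\<close> forces
  everything, and \<open>lower_check\<close> excludes size \<open>b + 3\<close>.\<close>

definition petersen_check :: "nat \<Rightarrow> nat \<Rightarrow> bool list \<Rightarrow> bool list \<Rightarrow> bool" where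
  "petersen_check n b us vs \<longleftrightarrow>
     n > 6 \<and> b + 3 < 2 * n \<and> length us \<le> n \<and> length vs \<le> n \<and>
     length (filter id us) + length (filter id vs) = b + 4 \<and>
     forces_all (2 * n) (pad n us) (pad n vs) \<and> lower_check n b"

lemma zero_forcing_number_petersen:
  assumes check: "petersen_check n b us vs" and z: "z = b + 4"
  shows "zero_forcing_number (generalized_petersen n 3) = z"
proof -
  have n: "n > 6" and len: "length (pad n us) = n" "length (pad n vs) = n"
    using check by (simp_all add: petersen_check_def pad_def)
  have "card (black (pad n us) (pad n vs)) = Suc (b + 3)"
    using check unfolding card_black pad_def petersen_check_def by simp
  moreover have "zero_forcing_set (generalized_petersen n 3) (black (pad n us) (pad n vs))"
    using check len by (intro zero_forcing_set_of_forces_all[OF n]) (auto simp: petersen_check_def)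
  moreover have "secure (generalized_petersen n 3) (b + 3) {}"
    using check by (intro secure_of_lower_check) (auto simp: petersen_check_def)
  ultimately show ?thesis
    using zero_forcing_number_eqI[OF finite_verts] z by fastforce
qed

section \<open>Certificates for n from 7 to 20\<close>

lemma zero_forcing_number_petersen_7:
  "zero_forcing_number (generalized_petersen 7 3) = 6"
  by (rule zero_forcing_number_petersen[where b = 2 and us = "replicate 6 True" and vs = "[]"]) code_simp+

lemma zero_forcing_number_petersen_8:
  "zero_forcing_number (generalized_petersen 8 3) = 6"
  by (rule zero_forcing_number_petersen[where b = 2 and us = "replicate 6 True" and vs = "[]"]) code_simp+

lemma zero_forcing_number_petersen_9:
  "zero_forcing_number (generalized_petersen 9 3) = 6"
  \<comment> \<open>The inner cycles are triangles here. Once \<open>V 2\<close> is forced, it and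
    \<open>V 5\<close> complete the triangle with \<open>V 8\<close>.\<close>
  by (rule zero_forcing_number_petersen[where b = 2 and us = "replicate 5 True" and vs = "replicate 5 False @ [True]"]) code_simp+

lemma zero_forcing_number_petersen_10:
  "zero_forcing_number (generalized_petersen 10 3) = 8"
  \<comment> \<open>\<open>U 1\<close> to \<open>U 6\<close> force \<open>V 1\<close> to
    \<open>V 6\<close>, then \<open>V 3\<close> and \<open>V 4\<close> force \<open>V 0\<close> and
    \<open>V 7\<close>; after that the block of eight columns grows step by step around the graph.
    The same witness serves all n from 13 on.\<close>
  by (rule zero_forcing_number_petersen[where b = 4 and us = "replicate 8 True" and vs = "[]"]) code_simp+

lemma zero_forcing_number_petersen_11:
  "zero_forcing_number (generalized_petersen 11 3) = 7"
  \<comment> \<open>The extra \<open>V 0\<close> lets \<open>U 0\<close> force its outer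
    predecessor, and lets \<open>V 3\<close>, once forced, force \<open>V 6\<close>.\<close>
  by (rule zero_forcing_number_petersen[where b = 3 and us = "replicate 6 True" and vs = "[True]"]) code_simp+

lemma zero_forcing_number_petersen_12:
  "zero_forcing_number (generalized_petersen 12 3) = 7"
  by (rule zero_forcing_number_petersen[where b = 3 and us = "replicate 6 True" and vs = "[True]"]) code_simp+

lemma zero_forcing_number_petersen_13:
  "zero_forcing_number (generalized_petersen 13 3) = 8"
  by (rule zero_forcing_number_petersen[where b = 4 and us = "replicate 8 True" and vs = "[]"]) code_simp+

lemma zero_forcing_number_petersen_14:
  "zero_forcing_number (generalized_petersen 14 3) = 8"
  by (rule zero_forcing_number_petersen[where b = 4 and us = "replicate 8 True" and vs = "[]"]) code_simp+

lemma zero_forcing_number_petersen_15: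
  "zero_forcing_number (generalized_petersen 15 3) = 8"
  by (rule zero_forcing_number_petersen[where b = 4 and us = "replicate 8 True" and vs = "[]"]) code_simp+

lemma zero_forcing_number_petersen_16:
  "zero_forcing_number (generalized_petersen 16 3) = 8"
  by (rule zero_forcing_number_petersen[where b = 4 and us = "replicate 8 True" and vs = "[]"]) code_simp+

lemma zero_forcing_number_petersen_17:
  "zero_forcing_number (generalized_petersen 17 3) = 8"
  by (rule zero_forcing_number_petersen[where b = 4 and us = "replicate 8 True" and vs = "[]"]) code_simp+

lemma zero_forcing_number_petersen_18:
  "zero_forcing_number (generalized_petersen 18 3) = 8"
  by (rule zero_forcing_number_petersen[where b = 4 and us = "replicate 8 True" and vs = "[]"]) code_simp+

lemma zero_forcing_number_petersen_19:
  "zero_forcing_number (generalized_petersen 19 3) = 8"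
  by (rule zero_forcing_number_petersen[where b = 4 and us = "replicate 8 True" and vs = "[]"]) code_simp+

lemma zero_forcing_number_petersen_20:
  "zero_forcing_number (generalized_petersen 20 3) = 8"
  by (rule zero_forcing_number_petersen[where b = 4 and us = "replicate 8 True" and vs = "[]"]) code_simp+

theorem mainTheorem3:
  shows "zero_forcing_number (generalized_petersen 7 3) = 6 \<and>
    zero_forcing_number (generalized_petersen 8 3) = 6 \<and>
    zero_forcing_number (generalized_petersen 9 3) = 6 \<and>
    zero_forcing_number (generalized_petersen 10 3) = 8 \<and>
    zero_forcing_number (generalized_petersen 11 3) = 7 \<and>
    zero_forcing_number (generalized_petersen 12 3) = 7 \<and>
    (\<forall>n. 13 \<le> n \<and> n \<le> 20 \<longrightarrow> zero_forcing_number (generalized_petersen n 3) = 8)"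
proof (intro conjI allI impI)
  fix n :: nat
  assume "13 \<le> n \<and> n \<le> 20"
  then have "n \<in> {13, 14, 15, 16, 17, 18, 19, 20}" by auto
  then show "zero_forcing_number (generalized_petersen n 3) = 8"
    using zero_forcing_number_petersen_13 zero_forcing_number_petersen_14
      zero_forcing_number_petersen_15 zero_forcing_number_petersen_16
      zero_forcing_number_petersen_17 zero_forcing_number_petersen_18
      zero_forcing_number_petersen_19 zero_forcing_number_petersen_20 by blast
qed (fact zero_forcing_number_petersen_7 zero_forcing_number_petersen_8
    zero_forcing_number_petersen_9 zero_forcing_number_petersen_10
    zero_forcing_number_petersen_11 zero_forcing_number_petersen_12)+

end
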